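(* Suppose that there are $q>0$, $\chi\in\mathbb{R}^p_{\ge0}$ with $|\chi|_1=\sum_i\chi_i<1$ and $y_0\in\mathbb{R}^p$ such that, with $q':=\min\{q,1\}$ and $|z|_{\chi,q'}:=(\sum_{i=1}^p|z_i|^{q'}\chi_i)^{1/q'}$: $(y,u)\mapsto G_\varepsilon(y,u)$ is continuous for all $\varepsilon$, $\|\sup_{u\in[0,1]}|G_{\varepsilon_0}(y_0,u)|\|_q<\infty$, and $$\Big\|\sup_{u\in[0,1]}\sup_{y\ne y'}\frac{|G_{\varepsilon_0}(y,u)-G_{\varepsilon_0}(y',u)|}{|y-y'|_{\chi,q'}}\Big\|_q\le1$$ (with the convention $0/0:=0$). Then for each $t\in\mathbb{Z}$ there exists a continuous modification $(\hat X_t(u))_{u\in[0,1]}$ of $(\tilde X_t(u))_{u\in[0,1]}$ (i.e. $u\mapsto\hat X_t(u)$ is continuous and for all $u\in[0,1]$, $\hat X_t(u)=\tilde X_t(u)$ a.s.) with $\sup_{u\in[0,1]}|\hat X_t(u)|\in L^q$.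
   Context: $(\varepsilon_t)_{t\in\mathbb{Z}}$ are i.i.d. real random variables, $\mathcal{F}_t:=(\varepsilon_t,\varepsilon_{t-1},\dots)$, $p\in\mathbb{N}$, and $G:\mathbb{R}\times\mathbb{R}^p\times[0,1]\to\mathbb{R}$, $(\varepsilon,y,u)\mapsto G_\varepsilon(y,u)$, is measurable. $\|W\|_q:=(\mathbb{E}|W|^q)^{1/q}$; $W\in L^q$ means $\mathbb{E}|W|^q<\infty$ (also for $0<q<1$). For $u\in[0,1]$, $(\tilde X_t(u))_{t\in\mathbb{Z}}$ denotes the a.s. unique $\mathcal{F}_t$-measurable, stationary and ergodic solution of $\tilde X_t(u)=G_{\varepsilon_t}(\tilde X_{t-1}(u),\dots,\tilde X_{t-p}(u),u)$, $t\in\mathbb{Z}$ (which exists under the conditions on $G$ assumed in the claim). *)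

theory Defs
  imports "HOL-Probability.Probability"
begin

definition iid :: "'a measure \<Rightarrow> (int \<Rightarrow> 'a \<Rightarrow> real) \<Rightarrow> bool" where
  "iid M eps \<longleftrightarrow> prob_space.indep_vars M (\<lambda>_. borel) eps UNIV \<and>
     (\<forall>s t. distr M borel (eps s) = distr M borel (eps t))"

definition past_sigma :: "'a measure \<Rightarrow> (int \<Rightarrow> 'a \<Rightarrow> real) \<Rightarrow> int \<Rightarrow> 'a measure" where
  "past_sigma M eps t =
     sigma (space M) (\<Union>s\<in>{..t}. {eps s -` A \<inter> space M | A. A \<in> sets borel})"

definition stationary :: "'a measure \<Rightarrow> (int \<Rightarrow> 'a \<Rightarrow> real) \<Rightarrow> bool" where
  "stationary M X \<longleftrightarrow> (\<forall>t. X t \<in> borel_measurable M) \<and>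
     (\<forall>k. distr M (PiM UNIV (\<lambda>_. borel)) (\<lambda>\<omega> t. X (t + k) \<omega>) =
          distr M (PiM UNIV (\<lambda>_. borel)) (\<lambda>\<omega> t. X t \<omega>))"

text \<open>Ergodicity of the path law: every shift-invariant measurable set of two-sided
  paths has probability 0 or 1.\<close>

definition ergodic :: "'a measure \<Rightarrow> (int \<Rightarrow> 'a \<Rightarrow> real) \<Rightarrow> bool" where
  "ergodic M X \<longleftrightarrow>
     (\<forall>A \<in> sets (PiM UNIV (\<lambda>_::int. borel :: real measure)).
        (\<lambda>x t. x (t + 1)) -` A = A \<longrightarrow>
        measure M {\<omega> \<in> space M. (\<lambda>t. X t \<omega>) \<in> A} \<in> {0, 1})"

text \<open>The coordinates of a vector of past values are indexed by an arbitrary finite type,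
  and \<^term>\<open>lag i \<in> {1..p}\<close> is the time lag belonging to the coordinate \<^term>\<open>i\<close>;
  so the vector below is \<open>(X (t - 1), \<dots>, X (t - p))\<close>.\<close>

definition past_values ::
    "('p::finite \<Rightarrow> nat) \<Rightarrow> (int \<Rightarrow> 'a \<Rightarrow> real) \<Rightarrow> int \<Rightarrow> 'a \<Rightarrow> real ^ 'p" where
  "past_values lag X t \<omega> = (\<chi> i. X (t - int (lag i)) \<omega>)"

definition causal_stationary_solution ::
    "'a measure \<Rightarrow> (int \<Rightarrow> 'a \<Rightarrow> real) \<Rightarrow> ('p::finite \<Rightarrow> nat) \<Rightarrow>
     (real \<Rightarrow> real ^ 'p \<Rightarrow> real \<Rightarrow> real) \<Rightarrow> real \<Rightarrow> (int \<Rightarrow> 'a \<Rightarrow> real) \<Rightarrow> bool" where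
  "causal_stationary_solution M eps lag G u X \<longleftrightarrow>
     (\<forall>t. X t \<in> borel_measurable (past_sigma M eps t)) \<and>
     stationary M X \<and> ergodic M X \<and>
     (\<forall>t. AE \<omega> in M. X t \<omega> = G (eps t \<omega>) (past_values lag X t \<omega>) u)"

text \<open>Suprema and quotients of absolute values are formed in \<^typ>\<open>ennreal\<close>, so that no
  finiteness is built in. There \<open>0 / 0 = 0\<close> and \<open>c / 0 = \<infinity>\<close> for \<open>c > 0\<close>.\<close>

definition epowr :: "ennreal \<Rightarrow> real \<Rightarrow> ennreal" where
  "epowr x r = (if x = \<infinity> then \<infinity> else ennreal (enn2real x powr r))"  \<comment> \<open>only for \<open>r > 0\<close>\<close>

definition Lq_norm :: "'a measure \<Rightarrow> real \<Rightarrow> ('a \<Rightarrow> ennreal) \<Rightarrow> ennreal" where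
  "Lq_norm M q W = epowr (\<integral>\<^sup>+ \<omega>. epowr (W \<omega>) q \<partial>M) (1 / q)"

definition in_Lq :: "'a measure \<Rightarrow> real \<Rightarrow> ('a \<Rightarrow> ennreal) \<Rightarrow> bool" where
  "in_Lq M q W \<longleftrightarrow> W \<in> borel_measurable M \<and> (\<integral>\<^sup>+ \<omega>. epowr (W \<omega>) q \<partial>M) < \<infinity>"

definition chi_norm :: "real ^ 'p::finite \<Rightarrow> real \<Rightarrow> real ^ 'p \<Rightarrow> real" where
  "chi_norm c r z = (\<Sum>i\<in>UNIV. \<bar>z $ i\<bar> powr r * c $ i) powr (1 / r)"

definition lip_const ::
    "(real ^ 'p::finite \<Rightarrow> real) \<Rightarrow> (real ^ 'p \<Rightarrow> real \<Rightarrow> real) \<Rightarrow> ennreal" where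
  "lip_const N g = (SUP u\<in>{0..1}. SUP (y, y')\<in>{(y, y'). y \<noteq> y'}.
      ennreal \<bar>g y u - g y' u\<bar> / ennreal (N (y - y')))"

end

theory Submission
  imports Defs
begin

text \<open>For \<open>m \<in> \<int>\<close> let \<open>Z m\<close> be the process that vanishes before time \<open>m\<close> and follows the
  recursion from then on; it is continuous in \<open>u\<close> for every outcome. Since the random Lipschitz
  constant at time \<open>t\<close> is independent of the past, the \<open>q\<close>-th moment of
  \<open>sup\<^sub>u \<bar>Z (m - 1) t u - Z m t u\<bar>\<close> decays geometrically in \<open>t - m\<close>. Hence \<open>Z m t\<close> converges
  uniformly in \<open>u\<close> almost surely as \<open>m \<rightarrow> -\<infinity>\<close>, and the limit is continuous with supremum in
  \<open>L\<^sup>q\<close>. The same decay estimate, applied on an event where the given solution is bounded just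
  before time \<open>m\<close>, shows that the solution agrees with this limit almost surely.\<close>

subsection \<open>Weighted norms and suprema over the unit interval\<close>

text \<open>Jensen's inequality for the convex power, extended to weights of total mass
  \<open>s \<le> 1\<close>: normalising by \<open>s\<close> produces the factor
  \<open>s powr r\<close>, which is at most \<open>s\<close> because
  \<open>r \<ge> 1\<close>.\<close>

lemma powr_weighted_sum_le:
  fixes w x :: "'i \<Rightarrow> real"
  assumes "finite I" and w: "\<And>i. i \<in> I \<Longrightarrow> 0 \<le> w i" and w1: "sum w I \<le> 1"
    and x: "\<And>i. i \<in> I \<Longrightarrow> 0 \<le> x i" and r: "1 \<le> r"
  shows "(\<Sum>i\<in>I. w i * x i) powr r \<le> (\<Sum>i\<in>I. w i * x i powr r)"
proof -
  \<comment> \<open>Only terms with positive weight and positive argument contribute to either sum;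
    if any remain, their total weight \<open>s\<close> is positive and can be divided by.\<close>
  define J where "J = {i\<in>I. 0 < w i \<and> 0 < x i}"
  define s where "s = sum w J"
  have J: "finite J" "J \<subseteq> I" using \<open>finite I\<close> by (auto simp: J_def)
  have zero: "w i = 0 \<or> x i = 0" if "i \<in> I - J" for i
    using that w[of i] x[of i] by (auto simp: J_def)
  have eq1: "(\<Sum>i\<in>I. w i * x i) = (\<Sum>i\<in>J. w i * x i)"
    using zero J \<open>finite I\<close> by (intro sum.mono_neutral_right) auto
  have eq2: "(\<Sum>i\<in>I. w i * x i powr r) = (\<Sum>i\<in>J. w i * x i powr r)"
    using zero J \<open>finite I\<close> by (intro sum.mono_neutral_right) fastforce+
  show ?thesis
  proof (cases "J = {}")
    case True
    then show ?thesis using eq1 eq2 by simp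
  next
    case False
    have s: "0 < s" unfolding s_def using J False by (intro sum_pos) (auto simp: J_def)
    have "s \<le> sum w I" unfolding s_def using J w \<open>finite I\<close> by (intro sum_mono2) auto
    then have s1: "s \<le> 1" using w1 by simp
    have "(\<Sum>i\<in>J. (w i / s) *\<^sub>R x i) powr r \<le> (\<Sum>i\<in>J. (w i / s) * x i powr r)"
    proof (rule convex_on_sum[OF \<open>finite J\<close> False powr_convex[OF r]])
      show "(\<Sum>i\<in>J. w i / s) = 1"
        using s by (simp add: sum_divide_distrib[symmetric] s_def)
    qed (use s in \<open>auto simp: J_def\<close>)
    then have A: "((\<Sum>i\<in>J. w i * x i) / s) powr r \<le> (\<Sum>i\<in>J. w i * x i powr r) / s"
      by (simp add: sum_divide_distrib)
    have pos: "0 \<le> (\<Sum>i\<in>J. w i * x i)" by (intro sum_nonneg) (auto simp: J_def)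
    have pos2: "0 \<le> (\<Sum>i\<in>J. w i * x i powr r)" by (intro sum_nonneg) (auto simp: J_def)
    have "s powr r \<le> s powr 1" using s s1 r by (intro powr_mono') auto
    have "(\<Sum>i\<in>J. w i * x i) powr r = s powr r * ((\<Sum>i\<in>J. w i * x i) / s) powr r"
      using s pos by (simp add: powr_divide)
    also have "\<dots> \<le> s * ((\<Sum>i\<in>J. w i * x i powr r) / s)"
      using A \<open>s powr r \<le> s powr 1\<close> s by (intro mult_mono) auto
    also have "\<dots> = (\<Sum>i\<in>J. w i * x i powr r)" using s by simp
    finally show ?thesis using eq1 eq2 by simp
  qed
qed

lemma chi_norm_nonneg [simp]: "0 \<le> chi_norm c r z"
  by (simp add: chi_norm_def)

lemma chi_norm_mono:
  assumes "\<And>i. 0 \<le> c $ i" "0 < r" "\<And>i. \<bar>y $ i\<bar> \<le> \<bar>z $ i\<bar>"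
  shows "chi_norm c r y \<le> chi_norm c r z"
  unfolding chi_norm_def using assms
  by (intro powr_mono2 sum_mono mult_right_mono sum_nonneg mult_nonneg_nonneg) auto

lemma continuous_on_chi_norm:
  assumes "\<And>i. 0 \<le> c $ i" "0 < r" "continuous_on S f"
  shows "continuous_on S (\<lambda>x. chi_norm c r (f x))"
  unfolding chi_norm_def using assms
  by (intro continuous_on_powr' continuous_intros) (auto intro!: sum_nonneg)

text \<open>Since \<open>q / r \<ge> 1\<close>, Jensen applies to the numbers
  \<open>\<bar>z $ i\<bar> powr r\<close>. With \<open>r = min q 1\<close> this turns the
  contraction into a linear inequality between \<open>q\<close>-th moments, for \<open>q < 1\<close>
  and \<open>q \<ge> 1\<close> alike.\<close>

lemma chi_norm_powr_le:
  assumes c: "\<And>i. 0 \<le> c $ i" and "(\<Sum>i\<in>UNIV. c $ i) \<le> 1" and r: "0 < r" "r \<le> q"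
  shows "chi_norm c r z powr q \<le> (\<Sum>i\<in>UNIV. c $ i * \<bar>z $ i\<bar> powr q)"
proof -
  have "chi_norm c r z powr q = (\<Sum>i\<in>UNIV. c $ i * \<bar>z $ i\<bar> powr r) powr (q / r)"
    by (simp add: chi_norm_def powr_powr mult.commute)
  also have "\<dots> \<le> (\<Sum>i\<in>UNIV. c $ i * (\<bar>z $ i\<bar> powr r) powr (q / r))"
    using assms by (intro powr_weighted_sum_le) auto
  also have "\<dots> = (\<Sum>i\<in>UNIV. c $ i * \<bar>z $ i\<bar> powr q)"
    using r by (simp add: powr_powr)
  finally show ?thesis .
qed

section \<open>Powers and \<open>q\<close>-norms in \<open>ennreal\<close>\<close>

lemma epowr_mono: "0 < r \<Longrightarrow> x \<le> y \<Longrightarrow> epowr x r \<le> epowr y r"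
  by (auto simp: epowr_def top_unique less_top
      intro!: ennreal_leI powr_mono2 enn2real_mono)

lemma epowr_ennreal: "0 \<le> a \<Longrightarrow> epowr (ennreal a) r = ennreal (a powr r)"
  by (simp add: epowr_def)

lemma borel_measurable_epowr [measurable]: "(\<lambda>x. epowr x r) \<in> borel_measurable borel"
  unfolding epowr_def by measurable

lemma Lq_norm_finite_imp: "Lq_norm M q W < \<infinity> \<Longrightarrow> (\<integral>\<^sup>+ \<omega>. epowr (W \<omega>) q \<partial>M) < \<infinity>"
  by (auto simp: Lq_norm_def epowr_def less_top split: if_splits)

lemma Lq_norm_le_one_imp:
  assumes "0 < q" "Lq_norm M q W \<le> 1"
  shows "(\<integral>\<^sup>+ \<omega>. epowr (W \<omega>) q \<partial>M) \<le> 1"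
proof -
  define I where "I = (\<integral>\<^sup>+ \<omega>. epowr (W \<omega>) q \<partial>M)"
  have *: "epowr I (1/q) \<le> 1" using assms by (simp add: Lq_norm_def I_def)
  then have fin: "I \<noteq> \<infinity>" by (auto simp: epowr_def top_unique)
  have "enn2real I powr (1/q) \<le> 1" using * fin by (simp add: epowr_def)
  then have "enn2real I \<le> 1" using \<open>0 < q\<close>
    by (smt (verit) divide_pos_pos enn2real_nonneg gr_one_powr)
  then show ?thesis using fin unfolding I_def[symmetric]
    by (metis ennreal_1 ennreal_enn2real ennreal_leI infinity_ennreal_def less_top)
qed

section \<open>Suprema of continuous functions over the unit interval\<close>

lemma countable_dense_unit_interval:
  obtains U :: "real set" where "countable U" "U \<noteq> {}" "U \<subseteq> {0..1}" "closure U = {0..1}"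
proof -
  obtain U :: "real set" where U: "countable U" "U \<subseteq> {0..1}" "{0..1} \<subseteq> closure U"
    using separable by blast
  then have "closure U = {0..1}" using closure_minimal[of U "{0..1}"] by auto
  moreover have "U \<noteq> {}" using U(3) by auto
  ultimately show ?thesis using U that by blast
qed

lemma bdd_above_image_unit:
  fixes f :: "real \<Rightarrow> real"
  assumes "continuous_on {0..1} f" "U \<subseteq> {0..1}"
  shows "bdd_above (f ` U)"
proof -
  have "bdd_above (f ` {0..1})"
    using compact_continuous_image[OF assms(1)] by (intro bounded_imp_bdd_above compact_imp_bounded) auto
  then show ?thesis using assms(2) by (meson bdd_above_mono image_mono)
qed

lemma cSUP_dense_unit:
  fixes f :: "real \<Rightarrow> real"
  assumes f: "continuous_on {0..1} f" and U: "U \<noteq> {}" "U \<subseteq> {0..1}" "closure U = {0..1}"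
  shows "(SUP u\<in>{0..1}. f u) = (SUP u\<in>U. f u)"
proof (rule antisym)
  show "(SUP u\<in>{0..1}. f u) \<le> (SUP u\<in>U. f u)"
  proof (rule cSUP_least)
    fix u :: real assume "u \<in> {0..1}"
    then show "f u \<le> (SUP u\<in>U. f u)"
      using f U bdd_above_image_unit[OF f U(2)]
      by - (rule continuous_le_on_closure[of U], auto intro: cSUP_upper)
  qed simp
  show "(SUP u\<in>U. f u) \<le> (SUP u\<in>{0..1}. f u)"
    using U bdd_above_image_unit[OF f order_refl] by (intro cSUP_subset_mono) auto
qed

text \<open>Continuity reduces the supremum to a countable dense set of parameters, where
  measurability is preserved.\<close>

lemma borel_measurable_SUP_unit:
  fixes f :: "real \<Rightarrow> 'a \<Rightarrow> real"
  assumes [measurable]: "\<And>u. u \<in> {0..1} \<Longrightarrow> f u \<in> borel_measurable M"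
    and c: "\<And>\<omega>. \<omega> \<in> space M \<Longrightarrow> continuous_on {0..1} (\<lambda>u. f u \<omega>)"
  shows "(\<lambda>\<omega>. SUP u\<in>{0..1}. f u \<omega>) \<in> borel_measurable M"
proof -
  obtain U :: "real set" where U: "countable U" "U \<noteq> {}" "U \<subseteq> {0..1}" "closure U = {0..1}"
    by (rule countable_dense_unit_interval)
  have "(\<lambda>\<omega>. SUP u\<in>U. f u \<omega>) \<in> borel_measurable M"
    using U c bdd_above_image_unit by (intro borel_measurable_cSUP) auto
  also have "?this \<longleftrightarrow> ?thesis"
    using U c by (intro measurable_cong cSUP_dense_unit[symmetric]) auto
  finally show ?thesis .
qed

text \<open>Translates the \<open>ennreal\<close> suprema of the claim into real ones; compactness
  of the interval makes them finite.\<close>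

lemma SUP_ennreal_unit:
  fixes f :: "real \<Rightarrow> real"
  assumes f: "continuous_on {0..1} f" and "\<And>u. u \<in> {0..1} \<Longrightarrow> 0 \<le> f u"
  shows "(SUP u\<in>{0..1}. ennreal (f u)) = ennreal (SUP u\<in>{0..1}. f u)"
proof (rule ennreal_SUP[symmetric])
  have "(SUP u\<in>{0..1}. ennreal (f u)) \<le> ennreal (SUP u\<in>{0..1}. f u)"
    by (intro SUP_least ennreal_leI cSUP_upper bdd_above_image_unit[OF f]) auto
  then show "(SUP u\<in>{0..1}. ennreal (f u)) \<noteq> \<top>"
    by (metis ennreal_neq_top neq_top_trans)
qed (use assms in auto)

lemma le_SUP_unit:
  fixes f :: "real \<Rightarrow> real"
  assumes "continuous_on {0..1} f" "u \<in> {0..1}"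
  shows "f u \<le> (SUP u\<in>{0..1}. f u)"
  using assms by (intro cSUP_upper bdd_above_image_unit) auto

lemma borel_measurable_vec_lambda:
  fixes f :: "'a \<Rightarrow> 'p::finite \<Rightarrow> real"
  assumes "\<And>i. (\<lambda>x. f x i) \<in> borel_measurable M"
  shows "(\<lambda>x. \<chi> i. f x i) \<in> borel_measurable M"
  using assms by (subst borel_measurable_euclidean_space) (auto simp: Basis_vec_def inner_axis)

subsection \<open>Random Lipschitz constants and independence of the past\<close>

text \<open>\<^const>\<open>lip_const\<close> is an uncountable supremum; a countable dense set of arguments
  gives a measurable minorant that, by continuity, is still a Lipschitz constant.\<close>

lemma lip_const_measurable_bound:
  fixes G :: "real \<Rightarrow> real ^ 'p::finite \<Rightarrow> real \<Rightarrow> real"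
  assumes meas: "\<And>y u. u \<in> {0..1} \<Longrightarrow> (\<lambda>e. G e y u) \<in> borel_measurable borel"
    and cont: "\<And>e. continuous_on (UNIV \<times> {0..1}) (\<lambda>(y, u). G e y u)"
    and c: "\<And>i. 0 \<le> c $ i" and r: "0 < r"
  obtains L :: "real \<Rightarrow> ennreal" where "L \<in> borel_measurable borel"
    and "\<And>e. L e \<le> lip_const (chi_norm c r) (G e)"
    and "\<And>e u y y'. L e \<noteq> \<infinity> \<Longrightarrow> u \<in> {0..1} \<Longrightarrow>
      \<bar>G e y u - G e y' u\<bar> \<le> enn2real (L e) * chi_norm c r (y - y')"
proof -
  let ?S = "UNIV \<times> UNIV \<times> {0..1} :: ((real ^ 'p) \<times> (real ^ 'p) \<times> real) set"
  obtain T where T: "countable T" "T \<subseteq> ?S" "?S \<subseteq> closure T"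
    using separable by blast
  have clT: "closure T = ?S"
    using T closure_minimal[of T ?S] by (auto intro!: closed_Times)
  define T' where "T' = {(y, y', u) \<in> T. y \<noteq> y'}"
  define L where "L e = (SUP (y, y', u)\<in>T'. ennreal \<bar>G e y u - G e y' u\<bar> / ennreal (chi_norm c r (y - y')))" for e
  have cT': "countable T'" using T(1) by (rule countable_subset[rotated]) (auto simp: T'_def)
  show thesis
  proof (rule that)
    show "L \<in> borel_measurable borel"
      unfolding L_def
    proof (rule borel_measurable_SUP[OF cT'], goal_cases)
      case (1 x)
      then obtain y y' u where x: "x = (y, y', u)" "u \<in> {0..1}" using T by (auto simp: T'_def)
      have [measurable]: "(\<lambda>e. G e y u) \<in> borel_measurable borel" "(\<lambda>e. G e y' u) \<in> borel_measurable borel"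
        using meas x by auto
      show ?case unfolding x(1) prod.case by measurable
    qed
    show "L e \<le> lip_const (chi_norm c r) (G e)" for e
      unfolding L_def
    proof (rule SUP_least, goal_cases)
      case (1 x)
      then obtain y y' u where x: "x = (y, y', u)" "u \<in> {0..1}" "y \<noteq> y'" using T by (auto simp: T'_def)
      have "ennreal \<bar>G e y u - G e y' u\<bar> / ennreal (chi_norm c r (y - y'))
         \<le> (SUP (y, y')\<in>{(y, y'). y \<noteq> y'}. ennreal \<bar>G e y u - G e y' u\<bar> / ennreal (chi_norm c r (y - y')))"
        using x by (intro SUP_upper2[of "(y, y')"]) auto
      also have "\<dots> \<le> lip_const (chi_norm c r) (G e)"
        unfolding lip_const_def using x(2) by (rule SUP_upper)
      finally show ?case by (simp add: x)
    qed
    fix e u and y y' :: "real ^ 'p" assume fin: "L e \<noteq> \<infinity>" and u: "u \<in> {0..1::real}"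
    \<comment> \<open>Clearing the denominator gives a continuous function, so it suffices to show
      \<open>?h \<le> 0\<close> on the dense set \<open>T\<close>, including the diagonal and the
      zeros of the norm.\<close>
    let ?h = "\<lambda>(y, y', u). \<bar>G e y u - G e y' u\<bar> - enn2real (L e) * chi_norm c r (y - y')"
    have c1: "continuous_on ?S (\<lambda>x. G e (fst x) (snd (snd x)))"
      by (rule continuous_on_compose2[OF cont[of e], of _ "\<lambda>x. (fst x, snd (snd x))", simplified])
         (auto intro!: continuous_intros)
    have c2: "continuous_on ?S (\<lambda>x. G e (fst (snd x)) (snd (snd x)))"
      using continuous_on_compose2[OF cont[of e] continuous_on_snd[OF continuous_on_id], of ?S]
      by (auto simp: case_prod_beta)
    have "continuous_on (closure T) ?h"
      unfolding clT case_prod_beta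
      by (intro continuous_intros c1 c2 continuous_on_chi_norm c r)
    moreover have "(y, y', u) \<in> closure T" using u clT by auto
    moreover have "?h x \<le> 0" if xT: "x \<in> T" for x
    proof -
      obtain z z' v where x: "x = (z, z', v)" by (cases x)
      show ?thesis
      proof (cases "z = z'")
        case False
        then have "(z, z', v) \<in> T'" using xT x by (auto simp: T'_def)
        then have *: "ennreal \<bar>G e z v - G e z' v\<bar> / ennreal (chi_norm c r (z - z')) \<le> L e"
          unfolding L_def by (intro SUP_upper2[of "(z, z', v)"]) auto
        have Le: "L e = ennreal (enn2real (L e))" using fin by (simp add: less_top)
        show ?thesis
        proof (cases "chi_norm c r (z - z') = 0")
          case True
          \<comment> \<open>\<open>chi_norm\<close> vanishes on some nonzero vectors if a weight is
            0. A positive numerator there would make the quotient infinite, against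
            \<open>L e \<noteq> \<infinity>\<close>.\<close>
          have "\<not> 0 < \<bar>G e z v - G e z' v\<bar>"
          proof
            assume "0 < \<bar>G e z v - G e z' v\<bar>"
            then have "ennreal \<bar>G e z v - G e z' v\<bar> / 0 = \<top>"
              by simp
            then show False using * fin True by (auto simp: top_unique)
          qed
          then show ?thesis using True x by simp
        next
          case False
          then have pos: "0 < chi_norm c r (z - z')" using chi_norm_nonneg[of c r "z - z'"] by linarith
          then have "ennreal (\<bar>G e z v - G e z' v\<bar> / chi_norm c r (z - z')) \<le> ennreal (enn2real (L e))"
            using * Le by (simp add: divide_ennreal)
          then have "\<bar>G e z v - G e z' v\<bar> / chi_norm c r (z - z') \<le> enn2real (L e)"
            by (simp add: ennreal_le_iff)
          then show ?thesis using pos x by (simp add: field_simps)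
        qed
      qed (use x in simp)
    qed
    ultimately have "?h (y, y', u) \<le> 0" by (rule continuous_le_on_closure)
    then show "\<bar>G e y u - G e y' u\<bar> \<le> enn2real (L e) * chi_norm c r (y - y')" by simp
  qed
qed

section \<open>The sigma-algebra of the past and independence from it\<close>

lemma space_past_sigma [simp]: "space (past_sigma M eps t) = space M"
  unfolding past_sigma_def by (rule space_measure_of) auto

lemma sets_past_sigma:
  "sets (past_sigma M eps t) =
     sigma_sets (space M) (\<Union>s\<in>{..t}. {eps s -` A \<inter> space M | A. A \<in> sets borel})"
  unfolding past_sigma_def by (rule sets_measure_of) auto

lemma measurable_past_sigma_eps:
  "s \<le> t \<Longrightarrow> eps s \<in> borel_measurable (past_sigma M eps t)"
  by (rule measurableI) (auto simp: sets_past_sigma intro!: sigma_sets.Basic)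

lemma measurable_past_sigma_mono:
  assumes "f \<in> borel_measurable (past_sigma M eps s)" "s \<le> t"
  shows "f \<in> borel_measurable (past_sigma M eps t)"
proof (rule measurable_mono[OF order_refl refl, THEN subsetD, OF _ _ assms(1)])
  show "sets (past_sigma M eps s) \<subseteq> sets (past_sigma M eps t)"
    unfolding sets_past_sigma using assms(2) by (intro sigma_sets_mono') force
qed simp

lemma measurable_past_sigma_imp:
  assumes "f \<in> borel_measurable (past_sigma M eps t)" "\<And>s. eps s \<in> borel_measurable M"
  shows "f \<in> borel_measurable M"
proof (rule measurable_mono[OF order_refl refl, THEN subsetD, OF _ _ assms(1)])
  show "sets (past_sigma M eps t) \<subseteq> sets M"
    unfolding sets_past_sigma using assms(2)
    by (intro sets.sigma_sets_subset) (auto intro: measurable_sets)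
qed simp

lemma (in prob_space) iid_measurable: "iid M eps \<Longrightarrow> eps t \<in> borel_measurable M"
  by (auto simp: iid_def indep_vars_def)

lemma (in prob_space) iid_nn_integral_cong:
  assumes "iid M eps" "f \<in> borel_measurable borel"
  shows "(\<integral>\<^sup>+ \<omega>. f (eps s \<omega>) \<partial>M) = (\<integral>\<^sup>+ \<omega>. f (eps t \<omega>) \<partial>M)"
proof -
  have "(\<integral>\<^sup>+ \<omega>. f (eps s \<omega>) \<partial>M) = (\<integral>\<^sup>+ x. f x \<partial>distr M borel (eps s))"
    using assms by (subst nn_integral_distr) (auto intro: iid_measurable)
  also have "\<dots> = (\<integral>\<^sup>+ x. f x \<partial>distr M borel (eps t))"
    using assms(1) unfolding iid_def by metis
  also have "\<dots> = (\<integral>\<^sup>+ \<omega>. f (eps t \<omega>) \<partial>M)"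
    using assms by (subst nn_integral_distr) (auto intro: iid_measurable)
  finally show ?thesis .
qed

text \<open>The index sets \<open>{t}\<close> and \<open>{..t - 1}\<close> are disjoint, so the
  sigma-algebras that they generate are independent, and the expectation of a product of functions
  measurable with respect to them factors.\<close>

lemma (in prob_space) iid_nn_integral_mult_past:
  fixes f :: "real \<Rightarrow> ennreal"
  assumes iid: "iid M eps" and f [measurable]: "f \<in> borel_measurable borel"
    and W: "W \<in> borel_measurable (past_sigma M eps (t - 1))"
  shows "(\<integral>\<^sup>+ \<omega>. f (eps t \<omega>) * W \<omega> \<partial>M) = (\<integral>\<^sup>+ \<omega>. f (eps t \<omega>) \<partial>M) * (\<integral>\<^sup>+ \<omega>. W \<omega> \<partial>M)"
proof -
  note [measurable] = iid_measurable[OF iid]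
  let ?E = "\<lambda>s. {eps s -` A \<inter> space M | A. A \<in> sets borel}"
  let ?I = "case_bool {t} {..t - 1}"
  have W' [measurable]: "W \<in> borel_measurable M"
    using W by (rule measurable_past_sigma_imp) measurable
  have "indep_sets ?E UNIV"
    using iid by (auto simp: iid_def indep_vars_def2)
  then have "indep_sets ?E (\<Union>j\<in>UNIV. ?I j)"
    by (rule indep_sets_mono_index[rotated]) auto
  then have "indep_sets (\<lambda>j. sigma_sets (space M) (\<Union>i\<in>?I j. ?E i)) UNIV"
  proof (rule indep_sets_collect_sigma)
    show "Int_stable (?E i)" for i
      by (auto simp: Int_stable_def) (metis sets.Int vimage_Int Int_assoc Int_left_commute Int_absorb)
    show "disjoint_family_on ?I UNIV"
      by (auto simp: disjoint_family_on_def split: bool.splits)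
  qed
  \<comment> \<open>\<open>f \<circ> eps t\<close> generates a sub-sigma-algebra of that of
    \<open>eps t\<close>, and \<open>W\<close> one of the past; independence is inherited.\<close>
  then have ind: "indep_sets (case_bool (sigma_sets (space M) {(f \<circ> eps t) -` A \<inter> space M | A. A \<in> sets borel})
      (sigma_sets (space M) {W -` A \<inter> space M | A. A \<in> sets borel})) UNIV"
  proof (rule indep_sets_mono_sets, goal_cases)
    case (1 j)
    show ?case
    proof (cases j)
      case True
      have "{(f \<circ> eps t) -` A \<inter> space M | A. A \<in> sets borel} \<subseteq> ?E t"
      proof (clarsimp, goal_cases)
        case (1 A)
        then have "f -` A \<in> sets borel" using measurable_sets[OF f 1] by simp
        then show ?case by (intro exI[of _ "f -` A"]) auto
      qed
      then show ?thesis using True by (auto intro!: sigma_sets_mono')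
    next
      case False
      have "{W -` A \<inter> space M | A. A \<in> sets borel} \<subseteq> sets (past_sigma M eps (t - 1))"
        using measurable_sets[OF W] by auto
      then show ?thesis using False
        by (auto simp: sets_past_sigma intro!: sigma_sets_mono)
    qed
  qed
  have "indep_var borel (f \<circ> eps t) borel W"
    unfolding indep_var_eq indep_set_def using ind by simp
  then have "indep_vars (\<lambda>_. borel) (case_bool (f \<circ> eps t) W) UNIV"
    unfolding indep_var_def by (rule indep_vars_cong[THEN iffD1, rotated -1]) (auto split: bool.split)
  from indep_vars_nn_integral[OF _ this] show ?thesis
    by (simp add: UNIV_bool comp_def mult.commute)
qed

subsection \<open>The recursion started at a finite time\<close>

text \<open>The maximum makes the recursion terminate for an arbitrary \<open>lag\<close>; it is irrelevant
  for lags in \<open>{1..p}\<close>.\<close>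

function forward :: "('p::finite \<Rightarrow> nat) \<Rightarrow> (real \<Rightarrow> real ^ 'p \<Rightarrow> real \<Rightarrow> real) \<Rightarrow>
    (int \<Rightarrow> real) \<Rightarrow> real \<Rightarrow> int \<Rightarrow> int \<Rightarrow> real" where
  "forward lag G e u m t = (if t < m then 0
     else G (e t) (\<chi> i. forward lag G e u m (t - int (max 1 (lag i)))) u)"
  by auto
termination
  \<comment> \<open>The \<open>+ 1\<close> keeps the measure positive at \<open>t = m\<close>, the
    smallest time that makes recursive calls.\<close>
  by (relation "Wellfounded.measure (\<lambda>(lag, G, e, u, m, t). nat (t + 1 - m))") auto

declare forward.simps [simp del]

lemma measurable_past_values:
  assumes "\<And>i. X (t - int (lag i)) \<in> borel_measurable N"
  shows "past_values lag X t \<in> borel_measurable N"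
proof -
  have "past_values lag X t = (\<lambda>\<omega>. \<chi> i. X (t - int (lag i)) \<omega>)"
    by (auto simp: past_values_def)
  then show ?thesis using borel_measurable_vec_lambda[OF assms] by simp
qed

text \<open>The form in which the hypotheses are used: \<open>l\<close> is a real, measurable
  Lipschitz constant, valid almost surely at each time, and the moment bound is moved from
  \<open>y0\<close> to \<open>0\<close> because the processes started at a finite time take their
  first step from zero values.\<close>

locale contracting_recursion = prob_space M
  for M :: "'a measure" +
  fixes eps :: "int \<Rightarrow> 'a \<Rightarrow> real"
    and G :: "real \<Rightarrow> real ^ 'p::finite \<Rightarrow> real \<Rightarrow> real"
    and lag :: "'p \<Rightarrow> nat"
    and q :: real
    and c :: "real ^ 'p"
    and l :: "real \<Rightarrow> real"
    and C :: real
  assumes iid: "iid M eps"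
    and lag: "bij_betw lag UNIV {1..CARD('p)}"
    and G_meas: "\<And>u. u \<in> {0..1} \<Longrightarrow> (\<lambda>(e, y). G e y u) \<in> borel_measurable borel"
    and G_cont: "\<And>e. continuous_on (UNIV \<times> {0..1}) (\<lambda>(y, u). G e y u)"
    and q_pos: "0 < q"
    and c_nonneg: "\<And>i. 0 \<le> c $ i"
    and c_sum: "(\<Sum>i\<in>UNIV. c $ i) < 1"
    and l_meas [measurable]: "l \<in> borel_measurable borel"
    and l_nonneg: "\<And>e. 0 \<le> l e"
    and l_int: "\<And>t. (\<integral>\<^sup>+ \<omega>. ennreal (l (eps t \<omega>) powr q) \<partial>M) \<le> 1"
    and l_lip: "\<And>t. AE \<omega> in M. \<forall>u\<in>{0..1}. \<forall>y y'.
      \<bar>G (eps t \<omega>) y u - G (eps t \<omega>) y' u\<bar> \<le> l (eps t \<omega>) * chi_norm c (min q 1) (y - y')"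
    and C_nonneg: "0 \<le> C"
    and G_zero: "\<And>t. (\<integral>\<^sup>+ \<omega>. ennreal ((SUP u\<in>{0..1}. \<bar>G (eps t \<omega>) 0 u\<bar>) powr q) \<partial>M) \<le> ennreal C"
begin

section \<open>Lags, the decay rate and decay of moments\<close>

lemma eps_meas [measurable]: "eps t \<in> borel_measurable M"
  using iid by (rule iid_measurable)

lemma lag_ge: "1 \<le> lag i" and lag_le: "lag i \<le> CARD('p)"
  using lag by (auto simp: bij_betw_def)

lemma lag_pos: "0 < lag i"
  using lag_ge[of i] by simp

lemma ex_lag:
  assumes "m - int CARD('p) \<le> s" "s < m"
  obtains i where "s = m - int (lag i)"
proof -
  have "nat (m - s) \<in> lag ` UNIV" using assms lag by (auto simp: bij_betw_def)
  then obtain i where "nat (m - s) = lag i" by auto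
  then show thesis using assms by (intro that[of i]) auto
qed

text \<open>The total weight is gained once per window of \<open>CARD('p)\<close> times, hence its
  root per time step. The maximum with \<open>1 / 2\<close> keeps the rate positive when all weights
  vanish.\<close>

definition rate :: real where
  "rate = max (\<Sum>i\<in>UNIV. c $ i) (1 / 2) powr (1 / CARD('p))"

lemma rate_pos: "0 < rate" and rate_less_one: "rate < 1"
  using c_sum powr_less_mono2[of "1 / CARD('p)" "max (\<Sum>i\<in>UNIV. c $ i) (1 / 2)" 1]
  by (auto simp: rate_def)

lemma c_sum_le_rate: "(\<Sum>i\<in>UNIV. c $ i) \<le> rate powr CARD('p)"
  by (simp add: rate_def powr_powr)

text \<open>By independence of \<open>l (eps t)\<close> from the past, \<open>E (d t)\<^sup>q\<close> is at most a
  weighted mean, with total weight below one, of the preceding \<open>CARD('p)\<close> moments.\<close>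

lemma moment_decay:
  fixes d :: "int \<Rightarrow> 'a \<Rightarrow> real"
  assumes meas: "\<And>s t. m \<le> t \<Longrightarrow> s < t \<Longrightarrow> d s \<in> borel_measurable (past_sigma M eps (t - 1))"
    and nonneg: "\<And>s \<omega>. 0 \<le> d s \<omega>"
    and rec: "\<And>t. m \<le> t \<Longrightarrow>
      AE \<omega> in M. d t \<omega> \<le> l (eps t \<omega>) * chi_norm c (min q 1) (past_values lag d t \<omega>)"
    and init: "\<And>s. m - int CARD('p) \<le> s \<Longrightarrow> s < m \<Longrightarrow>
      (\<integral>\<^sup>+ \<omega>. ennreal (d s \<omega> powr q) \<partial>M) \<le> ennreal K"
    and K: "0 \<le> K" and t: "m - int CARD('p) \<le> t"
  shows "(\<integral>\<^sup>+ \<omega>. ennreal (d t \<omega> powr q) \<partial>M) \<le> ennreal (K * rate powr (t - m + 1))"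
  using t
proof (induction "nat (t - (m - int CARD('p)))" arbitrary: t rule: less_induct)
  case less
  show ?case
  proof (cases "t < m")
    case True
    \<comment> \<open>In the initial window the exponent \<open>t - m + 1\<close> is at most 0, so
      the power of \<open>rate < 1\<close> is at least 1 and \<open>init\<close> suffices.\<close>
    have "rate powr 0 \<le> rate powr (t - m + 1)"
      using rate_pos rate_less_one True by (intro powr_mono') auto
    then have "K * 1 \<le> K * rate powr (t - m + 1)"
      using K rate_pos by (intro mult_left_mono) auto
    then show ?thesis
      using init[OF less.prems True] by (simp add: order_trans[OF _ ennreal_leI])
  next
    case False
    then have mt: "m \<le> t" by simp
    \<comment> \<open>\<open>W\<close> depends only on times before \<open>t\<close>, so its
      expectation separates from that of \<open>l (eps t) powr q\<close>.\<close>
    define W where "W \<omega> = (\<Sum>i\<in>UNIV. ennreal (c $ i) * ennreal (d (t - int (lag i)) \<omega> powr q))" for \<omega>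
    have dm: "d (t - int (lag i)) \<in> borel_measurable (past_sigma M eps (t - 1))" for i
      using meas[OF mt, of "t - int (lag i)"] lag_ge[of i] by auto
    have dM [measurable]: "d (t - int (lag i)) \<in> borel_measurable M" for i
      using dm by (rule measurable_past_sigma_imp) measurable
    have W: "W \<in> borel_measurable (past_sigma M eps (t - 1))"
      unfolding W_def using dm by measurable
    have W_eq: "W \<omega> = ennreal (\<Sum>i\<in>UNIV. c $ i * d (t - int (lag i)) \<omega> powr q)" for \<omega>
      unfolding W_def using c_nonneg by (simp add: ennreal_mult[symmetric])
    have "AE \<omega> in M. ennreal (d t \<omega> powr q) \<le> ennreal (l (eps t \<omega>) powr q) * W \<omega>"
      using rec[OF mt]
    proof eventually_elim
      case (elim \<omega>)
      let ?z = "past_values lag d t \<omega>"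
      have "d t \<omega> powr q \<le> (l (eps t \<omega>) * chi_norm c (min q 1) ?z) powr q"
        using elim nonneg q_pos by (intro powr_mono2) auto
      also have "\<dots> = l (eps t \<omega>) powr q * chi_norm c (min q 1) ?z powr q"
        by (rule powr_mult)
      also have "\<dots> \<le> l (eps t \<omega>) powr q * (\<Sum>i\<in>UNIV. c $ i * \<bar>?z $ i\<bar> powr q)"
        using c_nonneg c_sum q_pos by (intro mult_left_mono chi_norm_powr_le) auto
      also have "(\<Sum>i\<in>UNIV. c $ i * \<bar>?z $ i\<bar> powr q) = (\<Sum>i\<in>UNIV. c $ i * d (t - int (lag i)) \<omega> powr q)"
        by (simp add: past_values_def nonneg)
      finally have "ennreal (d t \<omega> powr q)
          \<le> ennreal (l (eps t \<omega>) powr q * (\<Sum>i\<in>UNIV. c $ i * d (t - int (lag i)) \<omega> powr q))"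
        by (rule ennreal_leI)
      also have "\<dots> = ennreal (l (eps t \<omega>) powr q) * W \<omega>"
        using c_nonneg by (simp add: ennreal_mult' W_eq)
      finally show ?case .
    qed
    then have "(\<integral>\<^sup>+ \<omega>. ennreal (d t \<omega> powr q) \<partial>M)
        \<le> (\<integral>\<^sup>+ \<omega>. ennreal (l (eps t \<omega>) powr q) * W \<omega> \<partial>M)"
      by (rule nn_integral_mono_AE)
    also have "\<dots> = (\<integral>\<^sup>+ \<omega>. ennreal (l (eps t \<omega>) powr q) \<partial>M) * (\<integral>\<^sup>+ \<omega>. W \<omega> \<partial>M)"
      using iid W by (intro iid_nn_integral_mult_past[where f = "\<lambda>e. ennreal (l e powr q)"]) auto
    also have "\<dots> \<le> 1 * (\<integral>\<^sup>+ \<omega>. W \<omega> \<partial>M)"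
      by (intro mult_right_mono l_int) simp
    also have "\<dots> = (\<Sum>i\<in>UNIV. ennreal (c $ i) * (\<integral>\<^sup>+ \<omega>. ennreal (d (t - int (lag i)) \<omega> powr q) \<partial>M))"
      unfolding W_def by (simp add: nn_integral_sum nn_integral_cmult)
    \<comment> \<open>The largest lag gives the weakest induction bound, so every lag is replaced by
      \<open>CARD('p)\<close>; the total weight, at most \<open>rate powr CARD('p)\<close>, makes up
      for the shift.\<close>
    also have "\<dots> \<le> (\<Sum>i\<in>UNIV. ennreal (c $ i) * ennreal (K * rate powr (t - m + 1 - CARD('p))))"
    proof (intro sum_mono mult_left_mono)
      fix i
      have "(\<integral>\<^sup>+ \<omega>. ennreal (d (t - int (lag i)) \<omega> powr q) \<partial>M)
          \<le> ennreal (K * rate powr (t - int (lag i) - m + 1))"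
        using mt lag_ge[of i] lag_le[of i] by (intro less.hyps) auto
      also have "\<dots> \<le> ennreal (K * rate powr (t - m + 1 - CARD('p)))"
        using K rate_pos rate_less_one lag_le[of i]
        by (intro ennreal_leI mult_left_mono powr_mono') auto
      finally show "(\<integral>\<^sup>+ \<omega>. ennreal (d (t - int (lag i)) \<omega> powr q) \<partial>M)
          \<le> ennreal (K * rate powr (t - m + 1 - CARD('p)))" .
    qed simp
    also have "\<dots> = ennreal ((\<Sum>i\<in>UNIV. c $ i) * (K * rate powr (t - m + 1 - CARD('p))))"
      using c_nonneg K by (simp add: ennreal_mult[symmetric] sum_ennreal sum_distrib_right)
    also have "\<dots> \<le> ennreal (rate powr CARD('p) * (K * rate powr (t - m + 1 - CARD('p))))"
      using K by (intro ennreal_leI mult_right_mono c_sum_le_rate) auto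
    also have "rate powr CARD('p) * (K * rate powr (t - m + 1 - CARD('p))) = K * rate powr (t - m + 1)"
      using rate_pos by (simp add: powr_diff)
    finally show ?thesis .
  qed
qed

section \<open>The processes started at finite times and the gaps between them\<close>

definition Z :: "int \<Rightarrow> int \<Rightarrow> real \<Rightarrow> 'a \<Rightarrow> real" where
  "Z m t u \<omega> = forward lag G (\<lambda>s. eps s \<omega>) u m t"

lemma Z_before: "t < m \<Longrightarrow> Z m t u \<omega> = 0"
  by (simp add: Z_def forward.simps)

lemma Z_rec: "m \<le> t \<Longrightarrow> Z m t u \<omega> = G (eps t \<omega>) (past_values lag (\<lambda>s. Z m s u) t \<omega>) u"
  using lag_ge unfolding Z_def past_values_def
  by (subst forward.simps) (simp add: max_absorb2)

lemma Z_measurable: "u \<in> {0..1} \<Longrightarrow> Z m t u \<in> borel_measurable (past_sigma M eps t)"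
proof (induction "nat (t + 1 - m)" arbitrary: t rule: less_induct)
  case less
  show ?case
  proof (cases "t < m")
    case True
    then have "Z m t u = (\<lambda>\<omega>. 0)" by (auto simp: Z_before)
    then show ?thesis by simp
  next
    case False
    have "past_values lag (\<lambda>s. Z m s u) t \<in> borel_measurable (past_sigma M eps t)"
    proof (rule measurable_past_values)
      fix i
      have "Z m (t - int (lag i)) u \<in> borel_measurable (past_sigma M eps (t - int (lag i)))"
        using False lag_ge[of i] less.prems by (intro less.hyps) auto
      then show "Z m (t - int (lag i)) u \<in> borel_measurable (past_sigma M eps t)"
        by (rule measurable_past_sigma_mono) auto
    qed
    then have "(\<lambda>\<omega>. (eps t \<omega>, past_values lag (\<lambda>s. Z m s u) t \<omega>)) \<in> borel_measurable (past_sigma M eps t)"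
      by (intro borel_measurable_Pair measurable_past_sigma_eps) auto
    from measurable_compose[OF this G_meas[OF less.prems]]
    show ?thesis using False by (simp add: Z_rec cong: measurable_cong)
  qed
qed

lemma Z_measurable_M [measurable]: "u \<in> {0..1} \<Longrightarrow> Z m t u \<in> borel_measurable M"
  by (rule measurable_past_sigma_imp[OF Z_measurable]) auto

lemma Z_continuous: "continuous_on {0..1} (\<lambda>u. Z m t u \<omega>)"
proof (induction "nat (t + 1 - m)" arbitrary: t rule: less_induct)
  case less
  show ?case
  proof (cases "t < m")
    case True
    then show ?thesis by (simp add: Z_before)
  next
    case False
    have "continuous_on {0..1} (\<lambda>u. Z m (t - int (lag i)) u \<omega>)" for i
      using False lag_ge[of i] by (intro less.hyps) auto
    then have "continuous_on {0..1} (\<lambda>u. (past_values lag (\<lambda>s. Z m s u) t \<omega>, u))"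
      unfolding past_values_def by (intro continuous_intros) auto
    from continuous_on_compose2[OF G_cont this]
    show ?thesis using False by (auto simp: Z_rec)
  qed
qed

text \<open>The supremum over \<open>u\<close> is taken before the expectation; this is what makes
  the convergence uniform in \<open>u\<close>.\<close>

definition gap :: "int \<Rightarrow> int \<Rightarrow> 'a \<Rightarrow> real" where
  "gap m t \<omega> = (SUP u\<in>{0..1}. \<bar>Z (m - 1) t u \<omega> - Z m t u \<omega>\<bar>)"

lemma gap_upper: "u \<in> {0..1} \<Longrightarrow> \<bar>Z (m - 1) t u \<omega> - Z m t u \<omega>\<bar> \<le> gap m t \<omega>"
  unfolding gap_def by (intro le_SUP_unit[of "\<lambda>u. \<bar>Z (m - 1) t u \<omega> - Z m t u \<omega>\<bar>"] continuous_intros Z_continuous)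

lemma gap_nonneg: "0 \<le> gap m t \<omega>"
  using gap_upper[of 0 m t \<omega>] by auto

lemma gap_measurable: "gap m t \<in> borel_measurable (past_sigma M eps t)"
proof -
  have "(\<lambda>\<omega>. SUP u\<in>{0..1}. \<bar>Z (m - 1) t u \<omega> - Z m t u \<omega>\<bar>) \<in> borel_measurable (past_sigma M eps t)"
    by (intro borel_measurable_SUP_unit borel_measurable_abs borel_measurable_diff Z_measurable
        continuous_intros Z_continuous)
  then show ?thesis by (simp add: gap_def[abs_def])
qed

lemma gap_measurable_M [measurable]: "gap m t \<in> borel_measurable M"
  by (rule measurable_past_sigma_imp[OF gap_measurable]) auto

text \<open>From time \<open>m\<close> on, both processes follow the same recursion with the same
  noise, so \<open>moment_decay\<close> applies; only the initial window needs a separate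
  look.\<close>

lemma gap_moment:
  assumes "m - int CARD('p) \<le> t"
  shows "(\<integral>\<^sup>+ \<omega>. ennreal (gap m t \<omega> powr q) \<partial>M) \<le> ennreal (C * rate powr (t - m + 1))"
proof (rule moment_decay[OF _ gap_nonneg _ _ C_nonneg assms])
  show "gap m s \<in> borel_measurable (past_sigma M eps (t - 1))" if "s < t" for s t
    using that by (intro measurable_past_sigma_mono[OF gap_measurable]) auto
  show "AE \<omega> in M. gap m t \<omega> \<le> l (eps t \<omega>) * chi_norm c (min q 1) (past_values lag (gap m) t \<omega>)"
    if mt: "m \<le> t" for t
    using l_lip[of t]
  proof eventually_elim
    case (elim \<omega>)
    show ?case unfolding gap_def[of m t \<omega>]
    proof (rule cSUP_least)
      fix u :: real assume u: "u \<in> {0..1}"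
      let ?P = "\<lambda>m. past_values lag (\<lambda>s. Z m s u) t \<omega>"
      have "\<bar>Z (m - 1) t u \<omega> - Z m t u \<omega>\<bar> \<le> l (eps t \<omega>) * chi_norm c (min q 1) (?P (m - 1) - ?P m)"
        using elim u mt by (simp add: Z_rec)
      \<comment> \<open>For each single \<open>u\<close> the differences are dominated
        coordinatewise by the gaps, and the weighted norm is monotone; thus the supremum moves
        inside the norm.\<close>
      also have "\<dots> \<le> l (eps t \<omega>) * chi_norm c (min q 1) (past_values lag (gap m) t \<omega>)"
        using u q_pos gap_upper[OF u] gap_nonneg
        by (intro mult_left_mono chi_norm_mono c_nonneg l_nonneg) (auto simp: past_values_def)
      finally show "\<bar>Z (m - 1) t u \<omega> - Z m t u \<omega>\<bar> \<le> \<dots>" .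
    qed simp
  qed
  show "(\<integral>\<^sup>+ \<omega>. ennreal (gap m s \<omega> powr q) \<partial>M) \<le> ennreal C" if "s < m" for s
  proof (cases "s = m - 1")
    case True
    \<comment> \<open>At time \<open>m - 1\<close> the earlier process takes its first step from
      zero past values while the later one is still zero; at earlier times both vanish.\<close>
    have "past_values lag (\<lambda>s. Z (m - 1) s u) (m - 1) \<omega> = 0" for u \<omega>
      by (auto simp: past_values_def vec_eq_iff lag_pos intro!: Z_before)
    then have "gap m s \<omega> = (SUP u\<in>{0..1}. \<bar>G (eps s \<omega>) 0 u\<bar>)" for \<omega>
      using True by (simp add: gap_def Z_before Z_rec)
    then show ?thesis using G_zero[of s] by simp
  next
    case False
    then have "gap m s \<omega> = 0" for \<omega> using that by (simp add: gap_def Z_before)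
    then show ?thesis by simp
  qed
qed

subsection \<open>The limit and its identification with the stationary solution\<close>

text \<open>Positivity of \<open>CARD('p)\<close> covers \<open>n = 0\<close>, where the process
  starts only at \<open>t + 1\<close>.\<close>

lemma window_le: "t + 1 - int n - int CARD('p) \<le> t"
  using zero_less_card_finite[where 'a = 'p] by linarith

text \<open>A single integrable variable \<open>B\<close> controls all gaps pathwise. This gives a
  geometric majorant independent of \<open>u\<close>, hence uniform convergence, and bounds the
  \<open>q\<close>-th power of the supremum by a multiple of \<open>B\<close>, without a triangle
  inequality in \<open>L^q\<close>.\<close>

lemma limit_process:
  obtains Y :: "real \<Rightarrow> 'a \<Rightarrow> real"
  where "\<And>u. u \<in> {0..1} \<Longrightarrow> Y u \<in> borel_measurable M"
    and "\<And>\<omega>. continuous_on {0..1} (\<lambda>u. Y u \<omega>)"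
    and "AE \<omega> in M. \<forall>u\<in>{0..1}. (\<lambda>N. Z (t + 1 - int N) t u \<omega>) \<longlonglongrightarrow> Y u \<omega>"
    and "in_Lq M q (\<lambda>\<omega>. SUP u\<in>{0..1}. ennreal \<bar>Y u \<omega>\<bar>)"
proof -
  \<comment> \<open>The square root splits the decay in two: one factor \<open>th ^ n\<close>
    absorbs the division in \<open>B\<close>, the other keeps the sum convergent. \<open>kap\<close>
    is the remaining pathwise rate after taking \<open>q\<close>-th roots.\<close>
  define th where "th = sqrt rate"
  define kap where "kap = th powr (1 / q)"
  have th: "0 < th" "th < 1" "rate = th * th"
    using rate_pos rate_less_one by (auto simp: th_def)
  have kap: "0 \<le> kap" "kap < 1"
    using th q_pos powr_less_mono2[of "1 / q" th 1] by (auto simp: kap_def)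
  define \<Delta> where "\<Delta> n = gap (t + 1 - int n) t" for n
  have \<Delta>_meas [measurable]: "\<Delta> n \<in> borel_measurable M" for n
    unfolding \<Delta>_def by measurable
  \<comment> \<open>\<open>B\<close> is integrable since \<open>rate / th = th < 1\<close>, and \<open>\<Delta> n \<le> (B * th\<^sup>n) powr (1 / q)\<close>
    is summable, uniformly in \<open>u\<close>, for every \<open>q > 0\<close>.\<close>
  define B where "B \<omega> = (\<Sum>n. ennreal (\<Delta> n \<omega> powr q / th ^ n))" for \<omega>
  have B_meas [measurable]: "B \<in> borel_measurable M" unfolding B_def by measurable
  have "(\<integral>\<^sup>+ \<omega>. B \<omega> \<partial>M) = (\<Sum>n. \<integral>\<^sup>+ \<omega>. ennreal (\<Delta> n \<omega> powr q / th ^ n) \<partial>M)"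
    unfolding B_def by (rule nn_integral_suminf) measurable
  also have "\<dots> \<le> (\<Sum>n. ennreal (C * th ^ n))"
  proof (intro suminf_le allI summableI)
    fix n
    have "(\<integral>\<^sup>+ \<omega>. ennreal (\<Delta> n \<omega> powr q / th ^ n) \<partial>M)
        = (\<integral>\<^sup>+ \<omega>. ennreal (1 / th ^ n) * ennreal (\<Delta> n \<omega> powr q) \<partial>M)"
      using th by (intro nn_integral_cong) (simp add: ennreal_mult[symmetric])
    also have "\<dots> = ennreal (1 / th ^ n) * (\<integral>\<^sup>+ \<omega>. ennreal (\<Delta> n \<omega> powr q) \<partial>M)"
      by (rule nn_integral_cmult) measurable
    \<comment> \<open>With \<open>m = t + 1 - int n\<close> the exponent \<open>t - m + 1\<close> in
      \<open>gap_moment\<close> is exactly \<open>n\<close>.\<close>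
    also have "\<dots> \<le> ennreal (1 / th ^ n) * ennreal (C * rate powr n)"
      using gap_moment[OF window_le[of t n]] by (intro mult_left_mono) (auto simp: \<Delta>_def)
    also have "\<dots> = ennreal (1 / th ^ n * (C * rate powr n))"
      using th C_nonneg by (subst ennreal_mult[symmetric]) auto
    also have "1 / th ^ n * (C * rate powr n) = C * th ^ n"
      using th by (simp add: powr_realpow power_mult_distrib)
    finally show "(\<integral>\<^sup>+ \<omega>. ennreal (\<Delta> n \<omega> powr q / th ^ n) \<partial>M) \<le> ennreal (C * th ^ n)" .
  qed
  also have "\<dots> = ennreal (\<Sum>n. C * th ^ n)"
    using th C_nonneg by (intro suminf_ennreal2 summable_mult summable_geometric) auto
  finally have B_int: "(\<integral>\<^sup>+ \<omega>. B \<omega> \<partial>M) < \<infinity>"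
    by (simp add: le_less_trans[OF _ ennreal_less_top])
  have B_fin: "AE \<omega> in M. B \<omega> < \<infinity>"
    using nn_integral_PInf_AE[OF B_meas] B_int by (auto simp: less_top)
  define b where "b \<omega> = enn2real (B \<omega>) powr (1 / q)" for \<omega>
  \<comment> \<open>The increments telescope from \<open>Z (t + 1) t\<close>, which is zero because
    that process has not started.\<close>
  define D where "D n u \<omega> = Z (t - int n) t u \<omega> - Z (t + 1 - int n) t u \<omega>" for n u \<omega>
  have D_sum: "(\<Sum>n<N. D n u \<omega>) = Z (t + 1 - int N) t u \<omega>" for N u \<omega>
    by (induction N) (simp_all add: D_def Z_before)
  have D_bound: "\<bar>D n u \<omega>\<bar> \<le> b \<omega> * kap ^ n" if "B \<omega> < \<infinity>" "u \<in> {0..1}" for n u \<omega>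
  proof -
    have "\<bar>D n u \<omega>\<bar> \<le> \<Delta> n \<omega>"
      using gap_upper[OF that(2), of "t + 1 - int n" t \<omega>] by (simp add: D_def \<Delta>_def)
    have "ennreal (\<Delta> n \<omega> powr q / th ^ n) \<le> B \<omega>"
      unfolding B_def using sum_le_suminf[of "\<lambda>n. ennreal (\<Delta> n \<omega> powr q / th ^ n)" "{n}"] by simp
    also have "B \<omega> = ennreal (enn2real (B \<omega>))" using that(1) by simp
    finally have "\<Delta> n \<omega> powr q / th ^ n \<le> enn2real (B \<omega>)" by (simp add: ennreal_le_iff)
    then have "\<Delta> n \<omega> powr q \<le> enn2real (B \<omega>) * th ^ n" using th by (simp add: field_simps)
    then have "(\<Delta> n \<omega> powr q) powr (1 / q) \<le> (enn2real (B \<omega>) * th ^ n) powr (1 / q)"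
      using q_pos by (intro powr_mono2) auto
    also have "(\<Delta> n \<omega> powr q) powr (1 / q) = \<Delta> n \<omega>"
      using q_pos gap_nonneg by (simp add: powr_powr \<Delta>_def)
    also have "(enn2real (B \<omega>) * th ^ n) powr (1 / q) = b \<omega> * kap ^ n"
      using th by (simp add: powr_mult b_def kap_def powr_realpow[symmetric] powr_powr mult.commute)
    finally show ?thesis using \<open>\<bar>D n u \<omega>\<bar> \<le> \<Delta> n \<omega>\<close> by simp
  qed
  have sm: "summable (\<lambda>n. b \<omega> * kap ^ n)" for \<omega>
    using kap by (intro summable_mult summable_geometric) auto
  \<comment> \<open>The default 0 on the null event where \<open>B\<close> is infinite makes
    \<open>Y\<close> continuous for every outcome.\<close>
  define Y where "Y u \<omega> = (if B \<omega> < \<infinity> then \<Sum>n. D n u \<omega> else 0)" for u \<omega>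
  have D_lim: "(\<lambda>N. Z (t + 1 - int N) t u \<omega>) \<longlonglongrightarrow> Y u \<omega>" if "B \<omega> < \<infinity>" "u \<in> {0..1}" for u \<omega>
  proof -
    have "summable (\<lambda>n. D n u \<omega>)"
      using D_bound[OF that] by (intro summable_comparison_test'[OF sm]) auto
    then show ?thesis using that by (auto simp: Y_def D_sum[symmetric] summable_LIMSEQ)
  qed
  have Y_meas [measurable]: "Y u \<in> borel_measurable M" if u: "u \<in> {0..1}" for u
  proof -
    have "(\<lambda>\<omega>. if B \<omega> < \<infinity> then Z (t + 1 - int N) t u \<omega> else 0) \<in> borel_measurable M" for N
      using Z_measurable_M[OF u] by measurable
    then show ?thesis
    proof (rule borel_measurable_LIMSEQ_real[rotated])
      show "(\<lambda>N. if B \<omega> < \<infinity> then Z (t + 1 - int N) t u \<omega> else 0) \<longlonglongrightarrow> Y u \<omega>" for \<omega>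
        using D_lim[OF _ u, of \<omega>] by (cases "B \<omega> < \<infinity>") (auto simp: Y_def)
    qed
  qed
  have Y_cont: "continuous_on {0..1} (\<lambda>u. Y u \<omega>)" for \<omega>
  proof (cases "B \<omega> < \<infinity>")
    case True
    have "uniform_limit {0..1} (\<lambda>N u. \<Sum>n<N. D n u \<omega>) (\<lambda>u. \<Sum>n. D n u \<omega>) sequentially"
      using D_bound[OF True] by (intro Weierstrass_m_test[OF _ sm]) auto
    then have "continuous_on {0..1} (\<lambda>u. \<Sum>n. D n u \<omega>)"
      by (rule uniform_limit_theorem[rotated]) (auto simp: D_sum Z_continuous)
    then show ?thesis using True by (simp add: Y_def)
  qed (simp add: Y_def)
  let ?S = "\<lambda>\<omega>. SUP u\<in>{0..1}. \<bar>Y u \<omega>\<bar>"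
  have S_eq: "(SUP u\<in>{0..1}. ennreal \<bar>Y u \<omega>\<bar>) = ennreal (?S \<omega>)" for \<omega>
    by (rule SUP_ennreal_unit) (auto intro!: continuous_intros Y_cont)
  have S_nonneg: "0 \<le> ?S \<omega>" for \<omega>
    using le_SUP_unit[of "\<lambda>u. \<bar>Y u \<omega>\<bar>" 0] continuous_on_rabs[OF Y_cont[of \<omega>]] by force
  \<comment> \<open>Summing the geometric majorant bounds the supremum by
    \<open>b \<omega> / (1 - kap)\<close>, and \<open>b \<omega> powr q\<close> is the real value of
    \<open>B \<omega>\<close>.\<close>
  have S_bound: "ennreal (?S \<omega> powr q) \<le> ennreal ((1 / (1 - kap)) powr q) * B \<omega>" if "B \<omega> < \<infinity>" for \<omega>
  proof -
    have "?S \<omega> \<le> b \<omega> * (1 / (1 - kap))"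
    proof (rule cSUP_least)
      fix u :: real assume u: "u \<in> {0..1}"
      have "\<bar>\<Sum>n. D n u \<omega>\<bar> \<le> (\<Sum>n. b \<omega> * kap ^ n)"
        using D_bound[OF that u] norm_suminf_le[OF _ sm, of "\<lambda>n. D n u \<omega>"] by auto
      also have "\<dots> = b \<omega> * (1 / (1 - kap))"
        using kap by (simp add: suminf_mult summable_geometric suminf_geometric)
      finally show "\<bar>Y u \<omega>\<bar> \<le> b \<omega> * (1 / (1 - kap))" using that by (simp add: Y_def)
    qed simp
    then have "?S \<omega> powr q \<le> (b \<omega> * (1 / (1 - kap))) powr q"
      using S_nonneg q_pos by (intro powr_mono2) auto
    also have "\<dots> = (1 / (1 - kap)) powr q * enn2real (B \<omega>)"
      using q_pos by (simp add: powr_mult b_def powr_powr powr_divide)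
    finally have "ennreal (?S \<omega> powr q) \<le> ennreal ((1 / (1 - kap)) powr q * enn2real (B \<omega>))"
      by (rule ennreal_leI)
    then show ?thesis using that by (simp add: ennreal_mult)
  qed
  show thesis
  proof (rule that)
    show "AE \<omega> in M. \<forall>u\<in>{0..1}. (\<lambda>N. Z (t + 1 - int N) t u \<omega>) \<longlonglongrightarrow> Y u \<omega>"
      using B_fin by eventually_elim (use D_lim in auto)
    have "(\<lambda>\<omega>. ?S \<omega>) \<in> borel_measurable M"
      by (intro borel_measurable_SUP_unit borel_measurable_abs Y_meas continuous_intros Y_cont)
    then have "(\<lambda>\<omega>. SUP u\<in>{0..1}. ennreal \<bar>Y u \<omega>\<bar>) \<in> borel_measurable M"
      unfolding S_eq by measurable
    moreover have "(\<integral>\<^sup>+ \<omega>. epowr (SUP u\<in>{0..1}. ennreal \<bar>Y u \<omega>\<bar>) q \<partial>M) < \<infinity>"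
    proof -
      have "(\<integral>\<^sup>+ \<omega>. epowr (SUP u\<in>{0..1}. ennreal \<bar>Y u \<omega>\<bar>) q \<partial>M)
          = (\<integral>\<^sup>+ \<omega>. ennreal (?S \<omega> powr q) \<partial>M)"
        unfolding S_eq using S_nonneg by (simp add: epowr_ennreal)
      also have "\<dots> \<le> (\<integral>\<^sup>+ \<omega>. ennreal ((1 / (1 - kap)) powr q) * B \<omega> \<partial>M)"
        using B_fin by (intro nn_integral_mono_AE) (auto elim!: eventually_mono intro: S_bound)
      also have "\<dots> = ennreal ((1 / (1 - kap)) powr q) * (\<integral>\<^sup>+ \<omega>. B \<omega> \<partial>M)"
        by (rule nn_integral_cmult) measurable
      also have "\<dots> < \<infinity>" using B_int by (simp add: ennreal_mult_less_top)
      finally show ?thesis .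
    qed
    ultimately show "in_Lq M q (\<lambda>\<omega>. SUP u\<in>{0..1}. ennreal \<bar>Y u \<omega>\<bar>)"
      by (simp add: in_Lq_def)
  qed (use Y_meas Y_cont in auto)
qed

text \<open>A stationary solution need not have moments, so the comparison with \<open>Z m\<close> is
  restricted to the event that the values just before time \<open>m\<close> are bounded; by stationarity
  its probability does not depend on \<open>m\<close>.\<close>

lemma forward_limit_unique:
  assumes u: "u \<in> {0..1}" and X: "causal_stationary_solution M eps lag G u X"
    and lim: "AE \<omega> in M. (\<lambda>N. Z (t + 1 - int N) t u \<omega>) \<longlonglongrightarrow> Y \<omega>"
    and Y [measurable]: "Y \<in> borel_measurable M"
  shows "AE \<omega> in M. Y \<omega> = X t \<omega>"
proof -
  have X_past: "X s \<in> borel_measurable (past_sigma M eps s)" for s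
    using X by (auto simp: causal_stationary_solution_def)
  have X_meas [measurable]: "X s \<in> borel_measurable M" for s
    using measurable_past_sigma_imp[OF X_past] by measurable
  have X_rec: "AE \<omega> in M. X s \<omega> = G (eps s \<omega>) (past_values lag X s \<omega>) u" for s
    using X by (auto simp: causal_stationary_solution_def)
  define \<tau> where "\<tau> K = prob {\<omega> \<in> space M. K < \<bar>X 0 \<omega>\<bar>}" for K
  \<comment> \<open>Stationarity equates laws on path space, so the tail event is written as a
    condition on coordinate 0 and pulled back along the shifted process.\<close>
  have tau: "emeasure M {\<omega> \<in> space M. K < \<bar>X s \<omega>\<bar>} = ennreal (\<tau> K)" for K s
  proof -
    let ?P = "PiM UNIV (\<lambda>_. borel) :: (int \<Rightarrow> real) measure"
    let ?A = "{x \<in> space ?P. K < \<bar>x 0\<bar>}"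
    have A: "?A \<in> sets ?P" by measurable
    have m: "(\<lambda>\<omega> r. X (r + k) \<omega>) \<in> measurable M ?P" for k
      by (intro measurable_PiM_single') auto
    have "emeasure (distr M ?P (\<lambda>\<omega> r. X (r + s) \<omega>)) ?A = emeasure (distr M ?P (\<lambda>\<omega> r. X r \<omega>)) ?A"
      using X by (simp add: causal_stationary_solution_def stationary_def)
    then have "emeasure M ((\<lambda>\<omega> r. X (r + s) \<omega>) -` ?A \<inter> space M)
        = emeasure M ((\<lambda>\<omega> r. X r \<omega>) -` ?A \<inter> space M)"
      using m[of s] m[of 0] A by (simp add: emeasure_distr)
    also have "(\<lambda>\<omega> r. X (r + s) \<omega>) -` ?A \<inter> space M = {\<omega> \<in> space M. K < \<bar>X s \<omega>\<bar>}"
      by (auto simp: space_PiM)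
    also have "(\<lambda>\<omega> r. X r \<omega>) -` ?A \<inter> space M = {\<omega> \<in> space M. K < \<bar>X 0 \<omega>\<bar>}"
      by (auto simp: space_PiM)
    finally show ?thesis by (simp add: \<tau>_def emeasure_eq_measure)
  qed
  have tau_lim: "(\<lambda>k. \<tau> (real k)) \<longlonglongrightarrow> 0"
  proof -
    have "(\<lambda>k. prob {\<omega> \<in> space M. real k < \<bar>X 0 \<omega>\<bar>})
        \<longlonglongrightarrow> prob (\<Inter>k. {\<omega> \<in> space M. real k < \<bar>X 0 \<omega>\<bar>})"
      by (rule finite_Lim_measure_decseq) (auto simp: decseq_def)
    also have "(\<Inter>k. {\<omega> \<in> space M. real k < \<bar>X 0 \<omega>\<bar>}) = {}"
    proof -
      have "\<exists>k. \<not> real k < \<bar>X 0 \<omega>\<bar>" for \<omega>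
        using reals_Archimedean2[of "\<bar>X 0 \<omega>\<bar>"] by (meson less_asym)
      then show ?thesis by auto
    qed
    finally show ?thesis by (simp add: \<tau>_def)
  qed
  \<comment> \<open>Truncation at 1 keeps the expectation finite without moments of
    \<open>X\<close>; since \<open>q > 0\<close>, \<open>e\<close> still vanishes only at 0.\<close>
  define e where "e x = ennreal (min 1 (\<bar>x\<bar> powr q))" for x :: real
  have e_meas [measurable]: "e \<in> borel_measurable borel" unfolding e_def by measurable
  have step: "(\<integral>\<^sup>+ \<omega>. e (X t \<omega> - Z (t + 1 - int N) t u \<omega>) \<partial>M)
      \<le> ennreal (CARD('p) * \<tau> K + K powr q * rate ^ N)" if K: "0 \<le> K" for K N
  proof -
    define m where "m = t + 1 - int N"
    \<comment> \<open>\<open>A\<close> involves only times before \<open>m\<close>, so multiplying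
      by its indicator keeps \<open>d\<close> measurable with respect to the past, as
      \<open>moment_decay\<close> requires.\<close>
    define A where "A = {\<omega> \<in> space M. \<forall>i. \<bar>X (m - int (lag i)) \<omega>\<bar> \<le> K}"
    have A_past: "A \<in> sets (past_sigma M eps (m - 1))"
    proof -
      have "X (m - int (lag i)) \<in> borel_measurable (past_sigma M eps (m - 1))" for i
        using lag_pos[of i] by (intro measurable_past_sigma_mono[OF X_past]) auto
      then have "{\<omega> \<in> space (past_sigma M eps (m - 1)). \<forall>i. \<bar>X (m - int (lag i)) \<omega>\<bar> \<le> K}
          \<in> sets (past_sigma M eps (m - 1))"
        by measurable
      then show ?thesis by (simp add: A_def)
    qed
    have [measurable]: "A \<in> sets M" unfolding A_def by measurable
    define d where "d s \<omega> = indicator A \<omega> * \<bar>X s \<omega> - Z m s u \<omega>\<bar>" for s \<omega>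
    have [measurable]: "d s \<in> borel_measurable M" for s
      using Z_measurable_M[OF u] unfolding d_def by measurable
    have "(\<integral>\<^sup>+ \<omega>. ennreal (d t \<omega> powr q) \<partial>M) \<le> ennreal (K powr q * rate powr (t - m + 1))"
    proof (rule moment_decay)
      fix s r :: int assume "m \<le> r" "s < r"
      have 1: "A \<in> sets (past_sigma M eps (r - 1))"
      proof -
        have "(indicator A :: 'a \<Rightarrow> real) \<in> borel_measurable (past_sigma M eps (m - 1))"
          using A_past by simp
        then have "(indicator A :: 'a \<Rightarrow> real) \<in> borel_measurable (past_sigma M eps (r - 1))"
          by (rule measurable_past_sigma_mono) (use \<open>m \<le> r\<close> in simp)
        then show ?thesis
          by (subst (asm) borel_measurable_indicator_iff) (simp add: A_def Int_def conj_commute cong: conj_cong)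
      qed
      have 2: "X s \<in> borel_measurable (past_sigma M eps (r - 1))"
        "Z m s u \<in> borel_measurable (past_sigma M eps (r - 1))"
        using \<open>s < r\<close> by (auto intro: measurable_past_sigma_mono[OF X_past]
            measurable_past_sigma_mono[OF Z_measurable[OF u]])
      show "d s \<in> borel_measurable (past_sigma M eps (r - 1))"
        unfolding d_def using 1 2 by measurable
    next
      fix r assume r: "m \<le> r"
      show "AE \<omega> in M. d r \<omega> \<le> l (eps r \<omega>) * chi_norm c (min q 1) (past_values lag d r \<omega>)"
        using X_rec[of r] l_lip[of r]
      proof eventually_elim
        case (elim \<omega>)
        let ?x = "past_values lag X r \<omega>" and ?z = "past_values lag (\<lambda>s. Z m s u) r \<omega>"
        show ?case
        proof (cases "\<omega> \<in> A")
          case True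
          have "d r \<omega> = \<bar>G (eps r \<omega>) ?x u - G (eps r \<omega>) ?z u\<bar>"
            using True elim(1) r by (simp add: d_def Z_rec)
          also have "\<dots> \<le> l (eps r \<omega>) * chi_norm c (min q 1) (?x - ?z)"
            using elim u by blast
          also have "\<dots> \<le> l (eps r \<omega>) * chi_norm c (min q 1) (past_values lag d r \<omega>)"
            using q_pos True
            by (intro mult_left_mono chi_norm_mono c_nonneg l_nonneg) (auto simp: past_values_def d_def)
          finally show ?thesis .
        qed (simp add: d_def l_nonneg)
      qed
    next
      fix s assume s: "m - int CARD('p) \<le> s" "s < m"
      obtain i where i: "s = m - int (lag i)" using ex_lag[OF s] by blast
      \<comment> \<open>Every time in the initial window is some \<open>m - int (lag i)\<close>;
        there \<open>Z m\<close> is zero, and \<open>X\<close> is bounded by \<open>K\<close> on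
        \<open>A\<close>, while \<open>d\<close> vanishes off \<open>A\<close>.\<close>
      have "d s \<omega> powr q \<le> K powr q" for \<omega>
        using s K q_pos by (intro powr_mono2) (auto simp: d_def Z_before A_def i indicator_def)
      then have "(\<integral>\<^sup>+ \<omega>. ennreal (d s \<omega> powr q) \<partial>M) \<le> (\<integral>\<^sup>+ \<omega>. ennreal (K powr q) \<partial>M)"
        by (intro nn_integral_mono ennreal_leI)
      then show "(\<integral>\<^sup>+ \<omega>. ennreal (d s \<omega> powr q) \<partial>M) \<le> ennreal (K powr q)"
        by (simp add: emeasure_space_1)
    next
      show "m - int CARD('p) \<le> t" unfolding m_def by (rule window_le)
    qed (auto simp: d_def)
    moreover have "rate powr (t - m + 1) = rate ^ N"
      using rate_pos by (simp add: m_def powr_realpow)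
    ultimately have d_int: "(\<integral>\<^sup>+ \<omega>. ennreal (d t \<omega> powr q) \<partial>M) \<le> ennreal (K powr q * rate ^ N)"
      by simp
    have "(\<integral>\<^sup>+ \<omega>. e (X t \<omega> - Z m t u \<omega>) \<partial>M)
        \<le> (\<integral>\<^sup>+ \<omega>. indicator (space M - A) \<omega> + ennreal (d t \<omega> powr q) \<partial>M)"
      \<comment> \<open>Off \<open>A\<close> the truncation bounds \<open>e\<close> by 1; on
        \<open>A\<close> it is at most \<open>d t \<omega> powr q\<close>.\<close>
      by (intro nn_integral_mono) (auto simp: e_def d_def indicator_def intro!: ennreal_leI ennreal_le_1[THEN iffD2])
    also have "\<dots> = emeasure M (space M - A) + (\<integral>\<^sup>+ \<omega>. ennreal (d t \<omega> powr q) \<partial>M)"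
      by (subst nn_integral_add) auto
    also have "emeasure M (space M - A) \<le> ennreal (CARD('p) * \<tau> K)"
    proof -
      have "space M - A = (\<Union>i. {\<omega> \<in> space M. K < \<bar>X (m - int (lag i)) \<omega>\<bar>})"
        unfolding A_def by (auto simp: not_le) (meson leD)
      then have "emeasure M (space M - A) \<le> (\<Sum>i\<in>UNIV. emeasure M {\<omega> \<in> space M. K < \<bar>X (m - int (lag i)) \<omega>\<bar>})"
        by (simp, intro emeasure_subadditive_finite) auto
      also have "\<dots> = ennreal (CARD('p) * \<tau> K)"
        by (simp add: tau ennreal_mult ennreal_of_nat_eq_real_of_nat \<tau>_def)
      finally show ?thesis .
    qed
    finally have "(\<integral>\<^sup>+ \<omega>. e (X t \<omega> - Z m t u \<omega>) \<partial>M)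
        \<le> ennreal (CARD('p) * \<tau> K) + ennreal (K powr q * rate ^ N)"
      using d_int by (meson add_mono order_refl order_trans)
    then show ?thesis
      using rate_pos by (simp add: m_def ennreal_plus \<tau>_def)
  qed
  \<comment> \<open>The order of limits matters: first \<open>N \<rightarrow> \<infinity>\<close> at
    fixed level \<open>k\<close>, by Fatou, which removes the term with \<open>rate ^ N\<close>;
    then \<open>k \<rightarrow> \<infinity>\<close> removes the tail probability.\<close>
  have "(\<integral>\<^sup>+ \<omega>. e (X t \<omega> - Y \<omega>) \<partial>M) \<le> ennreal (CARD('p) * \<tau> (real k))" for k
  proof -
    have "(\<integral>\<^sup>+ \<omega>. e (X t \<omega> - Y \<omega>) \<partial>M)
        \<le> (\<integral>\<^sup>+ \<omega>. liminf (\<lambda>N. e (X t \<omega> - Z (t + 1 - int N) t u \<omega>)) \<partial>M)"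
    proof (rule nn_integral_mono_AE)
      show "AE \<omega> in M. e (X t \<omega> - Y \<omega>) \<le> liminf (\<lambda>N. e (X t \<omega> - Z (t + 1 - int N) t u \<omega>))"
        using lim
      proof eventually_elim
        case (elim \<omega>)
        have "(\<lambda>N. min 1 (\<bar>X t \<omega> - Z (t + 1 - int N) t u \<omega>\<bar> powr q)) \<longlonglongrightarrow> min 1 (\<bar>X t \<omega> - Y \<omega>\<bar> powr q)"
          using elim q_pos by (intro tendsto_intros tendsto_powr') auto
        then have "(\<lambda>N. e (X t \<omega> - Z (t + 1 - int N) t u \<omega>)) \<longlonglongrightarrow> e (X t \<omega> - Y \<omega>)"
          unfolding e_def by (rule tendsto_ennrealI)
        then show ?case by (simp add: lim_imp_Liminf)
      qed
    qed
    also have "\<dots> \<le> liminf (\<lambda>N. \<integral>\<^sup>+ \<omega>. e (X t \<omega> - Z (t + 1 - int N) t u \<omega>) \<partial>M)"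
      by (intro nn_integral_liminf measurable_compose[OF _ e_meas] borel_measurable_diff
          X_meas Z_measurable_M u)
    also have "\<dots> \<le> liminf (\<lambda>N. ennreal (CARD('p) * \<tau> (real k) + real k powr q * rate ^ N))"
      by (intro Liminf_mono always_eventually allI step) simp
    also have "\<dots> = ennreal (CARD('p) * \<tau> (real k) + real k powr q * 0)"
      using rate_pos rate_less_one
      by (intro lim_imp_Liminf tendsto_ennrealI tendsto_intros LIMSEQ_realpow_zero) auto
    finally show ?thesis by simp
  qed
  moreover have "(\<lambda>k. ennreal (CARD('p) * \<tau> (real k))) \<longlonglongrightarrow> ennreal (real CARD('p) * 0)"
    by (intro tendsto_ennrealI tendsto_intros tau_lim)
  ultimately have "(\<integral>\<^sup>+ \<omega>. e (X t \<omega> - Y \<omega>) \<partial>M) \<le> ennreal (real CARD('p) * 0)"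
    by (intro LIMSEQ_le_const) auto
  then have "(\<integral>\<^sup>+ \<omega>. e (X t \<omega> - Y \<omega>) \<partial>M) = 0" by simp
  then have "AE \<omega> in M. e (X t \<omega> - Y \<omega>) = 0"
    by (subst (asm) nn_integral_0_iff_AE) auto
  then show ?thesis
    by eventually_elim (auto simp: e_def min_def split: if_splits)
qed

end

section \<open>From the hypotheses at time 0 and at \<open>y0\<close> to the locale\<close>

lemma ex_contracting_recursion:
  fixes G :: "real \<Rightarrow> real ^ 'p::finite \<Rightarrow> real \<Rightarrow> real"
  assumes "prob_space M" and iid: "iid M eps" and lag: "bij_betw lag UNIV {1..CARD('p)}"
    and meas: "(\<lambda>(e, y, u). G e y u) \<in>
           borel_measurable (borel \<Otimes>\<^sub>M borel \<Otimes>\<^sub>M restrict_space borel {0..1})"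
    and q: "0 < q" and c: "\<And>i. 0 \<le> c $ i" and c1: "(\<Sum>i\<in>UNIV. c $ i) < 1"
    and cont: "\<And>e. continuous_on (UNIV \<times> {0..1}) (\<lambda>(y, u). G e y u)"
    and fin: "Lq_norm M q (\<lambda>\<omega>. SUP u\<in>{0..1}. ennreal \<bar>G (eps 0 \<omega>) y0 u\<bar>) < \<infinity>"
    and lip: "Lq_norm M q (\<lambda>\<omega>. lip_const (chi_norm c (min q 1)) (G (eps 0 \<omega>))) \<le> 1"
  obtains l C where "contracting_recursion M eps G lag q c l C"
proof -
  interpret prob_space M by fact
  note [measurable] = iid_measurable[OF iid]
  have G_meas: "(\<lambda>(e, y). G e y u) \<in> borel_measurable borel" if u: "u \<in> {0..1}" for u
  proof -
    have "(\<lambda>x. (fst x, snd x, u)) \<in> borel \<rightarrow>\<^sub>M borel \<Otimes>\<^sub>M borel \<Otimes>\<^sub>M restrict_space borel {0..1}"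
      using u by (intro measurable_Pair measurable_const borel_measurable_continuous_onI continuous_intros)
        (auto simp: space_restrict_space)
    from measurable_compose[OF this meas] show ?thesis by (simp add: case_prod_beta)
  qed
  have G_meas1: "(\<lambda>e. G e y u) \<in> borel_measurable borel" if u: "u \<in> {0..1}" for y u
  proof -
    have "(\<lambda>e::real. (e, y)) \<in> borel_measurable borel"
      by (intro borel_measurable_Pair) auto
    from measurable_compose[OF this G_meas[OF u]] show ?thesis by simp
  qed
  have G_cont: "continuous_on {0..1} (\<lambda>u. \<bar>G e y u\<bar>)" for e y
    using continuous_on_compose2[OF cont[of e] continuous_on_Pair[
        OF continuous_on_const[of "{0..1}" y] continuous_on_id]]
    by (auto intro!: continuous_intros)
  obtain L where L_meas [measurable]: "L \<in> borel_measurable borel"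
    and L_le: "\<And>e. L e \<le> lip_const (chi_norm c (min q 1)) (G e)"
    and L_lip: "\<And>e u y y'. L e \<noteq> \<infinity> \<Longrightarrow> u \<in> {0..1} \<Longrightarrow>
      \<bar>G e y u - G e y' u\<bar> \<le> enn2real (L e) * chi_norm c (min q 1) (y - y')"
    using lip_const_measurable_bound[of G c "min q 1"] G_meas1 cont c q by auto
  \<comment> \<open>The integral is monotone also when the majorant \<open>lip_const\<close> is not
    measurable, so the norm bound passes to \<open>L\<close>.\<close>
  have "(\<integral>\<^sup>+ \<omega>. epowr (L (eps 0 \<omega>)) q \<partial>M)
      \<le> (\<integral>\<^sup>+ \<omega>. epowr (lip_const (chi_norm c (min q 1)) (G (eps 0 \<omega>))) q \<partial>M)"
    using q L_le by (intro nn_integral_mono epowr_mono)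
  also have "\<dots> \<le> 1" using q lip by (rule Lq_norm_le_one_imp)
  finally have L_int: "(\<integral>\<^sup>+ \<omega>. epowr (L (eps t \<omega>)) q \<partial>M) \<le> 1" for t
    using iid_nn_integral_cong[OF iid, of "\<lambda>e. epowr (L e) q" t 0] by simp
  have L_fin: "AE \<omega> in M. L (eps t \<omega>) \<noteq> \<infinity>" for t
  proof -
    have "AE \<omega> in M. epowr (L (eps t \<omega>)) q \<noteq> \<infinity>"
      using L_int[of t] by (intro nn_integral_PInf_AE) (auto simp: top_unique)
    then show ?thesis by eventually_elim (auto simp: epowr_def)
  qed
  \<comment> \<open>\<open>enn2real\<close> sends \<open>\<infinity>\<close> to 0, so
    \<open>l\<close> is a Lipschitz constant only where \<open>L\<close> is finite, which by
    \<open>L_fin\<close> is almost everywhere.\<close>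
  define l where "l e = enn2real (L e)" for e
  have l_meas [measurable]: "l \<in> borel_measurable borel" unfolding l_def by measurable
  have l_int: "(\<integral>\<^sup>+ \<omega>. ennreal (l (eps t \<omega>) powr q) \<partial>M) \<le> 1" for t
  proof -
    have "(\<integral>\<^sup>+ \<omega>. ennreal (l (eps t \<omega>) powr q) \<partial>M) \<le> (\<integral>\<^sup>+ \<omega>. epowr (L (eps t \<omega>)) q \<partial>M)"
      by (intro nn_integral_mono) (auto simp: epowr_def l_def)
    then show ?thesis using L_int[of t] by simp
  qed
  let ?S = "\<lambda>y e. SUP u\<in>{0..1}. \<bar>G e y u\<bar>"
  have S_nonneg: "0 \<le> ?S y e" for y e
    using le_SUP_unit[OF G_cont, of 0 e y] by (meson abs_ge_zero atLeastAtMost_iff order_refl order_trans zero_le_one)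
  have S_meas [measurable]: "?S y \<in> borel_measurable borel" for y
    using G_meas1 by (intro borel_measurable_SUP_unit G_cont borel_measurable_abs)
  let ?b = "chi_norm c (min q 1) (0 - y0)"
  \<comment> \<open>\<open>J\<close> arises from comparing \<open>0\<close> with \<open>y0\<close>:
    the Lipschitz term contributes \<open>l powr q\<close> times \<open>?b powr q\<close>, and the
    expectation of \<open>l powr q\<close> is at most 1.\<close>
  define J where "J = ennreal (2 powr q) * ((\<integral>\<^sup>+ \<omega>. ennreal (?S y0 (eps 0 \<omega>) powr q) \<partial>M) + ennreal (?b powr q))"
  have "(\<integral>\<^sup>+ \<omega>. ennreal (?S y0 (eps 0 \<omega>) powr q) \<partial>M) < \<infinity>"
    using Lq_norm_finite_imp[OF fin]
    by (subst (asm) SUP_ennreal_unit) (auto simp: G_cont epowr_ennreal S_nonneg)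
  then have J_fin: "J < \<infinity>" by (auto simp: J_def ennreal_mult_less_top)
  have zero: "(\<integral>\<^sup>+ \<omega>. ennreal (?S 0 (eps t \<omega>) powr q) \<partial>M) \<le> J" for t
  proof -
    have "(\<integral>\<^sup>+ \<omega>. ennreal (?S 0 (eps t \<omega>) powr q) \<partial>M) = (\<integral>\<^sup>+ \<omega>. ennreal (?S 0 (eps 0 \<omega>) powr q) \<partial>M)"
      by (rule iid_nn_integral_cong[OF iid]) measurable
    also have "\<dots> \<le> (\<integral>\<^sup>+ \<omega>. ennreal (2 powr q) *
        (ennreal (?S y0 (eps 0 \<omega>) powr q) + ennreal (l (eps 0 \<omega>) powr q) * ennreal (?b powr q)) \<partial>M)"
    proof (rule nn_integral_mono_AE)
      show "AE \<omega> in M. ennreal (?S 0 (eps 0 \<omega>) powr q) \<le> ennreal (2 powr q) *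
        (ennreal (?S y0 (eps 0 \<omega>) powr q) + ennreal (l (eps 0 \<omega>) powr q) * ennreal (?b powr q))"
        using L_fin[of 0]
      proof eventually_elim
        case (elim \<omega>)
        let ?e = "eps 0 \<omega>"
        let ?s = "?S y0 ?e" and ?m = "l ?e * ?b"
        have m: "0 \<le> ?m" by (simp add: l_def)
        have "?S 0 ?e \<le> ?s + ?m"
        proof (rule cSUP_least)
          fix u :: real assume u: "u \<in> {0..1}"
          have "\<bar>G ?e 0 u - G ?e y0 u\<bar> \<le> ?m" using L_lip[OF elim u, of 0 y0] by (simp add: l_def)
          moreover have "\<bar>G ?e y0 u\<bar> \<le> ?s" by (rule le_SUP_unit[OF G_cont u])
          ultimately show "\<bar>G ?e 0 u\<bar> \<le> ?s + ?m" by linarith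
        qed simp
        \<comment> \<open>Passing through the maximum gives the constant \<open>2 powr q\<close> for
          all \<open>q > 0\<close>, with no distinction between concave and convex powers.\<close>
        also have "\<dots> \<le> 2 * max ?s ?m" by linarith
        finally have "?S 0 ?e powr q \<le> (2 * max ?s ?m) powr q"
          using S_nonneg q by (intro powr_mono2) auto
        also have "\<dots> = 2 powr q * max ?s ?m powr q" by (rule powr_mult)
        also have "\<dots> \<le> 2 powr q * (?s powr q + ?m powr q)"
          by (intro mult_left_mono) (auto simp: max_def)
        also have "?m powr q = l ?e powr q * ?b powr q" by (rule powr_mult)
        finally have "ennreal (?S 0 ?e powr q) \<le> ennreal (2 powr q * (?s powr q + l ?e powr q * ?b powr q))"
          by (rule ennreal_leI)
        then show ?case by (simp add: ennreal_mult ennreal_plus)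
      qed
    qed
    also have "\<dots> = ennreal (2 powr q) * ((\<integral>\<^sup>+ \<omega>. ennreal (?S y0 (eps 0 \<omega>) powr q) \<partial>M)
        + (\<integral>\<^sup>+ \<omega>. ennreal (l (eps 0 \<omega>) powr q) \<partial>M) * ennreal (?b powr q))"
      by (simp add: nn_integral_cmult nn_integral_add nn_integral_multc)
    also have "\<dots> \<le> ennreal (2 powr q) * ((\<integral>\<^sup>+ \<omega>. ennreal (?S y0 (eps 0 \<omega>) powr q) \<partial>M)
        + 1 * ennreal (?b powr q))"
      by (intro mult_left_mono add_mono mult_right_mono l_int) auto
    finally show ?thesis by (simp add: J_def)
  qed
  have "contracting_recursion M eps G lag q c l (enn2real J)"
  proof (unfold_locales)
    fix t
    show "AE \<omega> in M. \<forall>u\<in>{0..1}. \<forall>y y'.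
      \<bar>G (eps t \<omega>) y u - G (eps t \<omega>) y' u\<bar> \<le> l (eps t \<omega>) * chi_norm c (min q 1) (y - y')"
      using L_fin[of t] by eventually_elim (use L_lip in \<open>auto simp: l_def\<close>)
    show "(\<integral>\<^sup>+ \<omega>. ennreal (?S 0 (eps t \<omega>) powr q) \<partial>M) \<le> ennreal (enn2real J)"
      using zero[of t] J_fin by simp
  qed (use iid lag G_meas cont q c c1 l_meas l_int in \<open>auto simp: l_def\<close>)
  then show thesis by (rule that)
qed

theorem theorem4p6:
  fixes M :: "'a measure"
    and eps :: "int \<Rightarrow> 'a \<Rightarrow> real"
    and G :: "real \<Rightarrow> real ^ 'p::finite \<Rightarrow> real \<Rightarrow> real"
    and lag :: "'p \<Rightarrow> nat"
    and X :: "real \<Rightarrow> int \<Rightarrow> 'a \<Rightarrow> real"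
    and q :: real
    and c y0 :: "real ^ 'p"
  assumes "prob_space M"
    and "iid M eps"
    and "bij_betw lag UNIV {1..CARD('p)}"
    and "(\<lambda>(e, y, u). G e y u) \<in>
           borel_measurable (borel \<Otimes>\<^sub>M borel \<Otimes>\<^sub>M restrict_space borel {0..1})"
    and "\<And>u. u \<in> {0..1} \<Longrightarrow> causal_stationary_solution M eps lag G u (X u)"
    and "q > 0"
    and "\<And>i. c $ i \<ge> 0"
    and "(\<Sum>i\<in>UNIV. c $ i) < 1"
    and "\<And>e. continuous_on (UNIV \<times> {0..1}) (\<lambda>(y, u). G e y u)"
    and "Lq_norm M q (\<lambda>\<omega>. SUP u\<in>{0..1}. ennreal \<bar>G (eps 0 \<omega>) y0 u\<bar>) < \<infinity>"
    and "Lq_norm M q (\<lambda>\<omega>. lip_const (chi_norm c (min q 1)) (G (eps 0 \<omega>))) \<le> 1"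
  shows "\<forall>t. \<exists>Xhat :: real \<Rightarrow> 'a \<Rightarrow> real.
           (\<forall>u\<in>{0..1}. Xhat u \<in> borel_measurable M) \<and>
           (\<forall>\<omega>\<in>space M. continuous_on {0..1} (\<lambda>u. Xhat u \<omega>)) \<and>
           (\<forall>u\<in>{0..1}. AE \<omega> in M. Xhat u \<omega> = X u t \<omega>) \<and>
           in_Lq M q (\<lambda>\<omega>. SUP u\<in>{0..1}. ennreal \<bar>Xhat u \<omega>\<bar>)"
proof
  fix t
  obtain l C where "contracting_recursion M eps G lag q c l C"
    using ex_contracting_recursion[OF assms(1-4) assms(6-11)] by blast
  then interpret contracting_recursion M eps G lag q c l C .
  obtain Y where Y: "\<And>u. u \<in> {0..1} \<Longrightarrow> Y u \<in> borel_measurable M"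
    "\<And>\<omega>. continuous_on {0..1} (\<lambda>u. Y u \<omega>)"
    "AE \<omega> in M. \<forall>u\<in>{0..1}. (\<lambda>N. Z (t + 1 - int N) t u \<omega>) \<longlonglongrightarrow> Y u \<omega>"
    "in_Lq M q (\<lambda>\<omega>. SUP u\<in>{0..1}. ennreal \<bar>Y u \<omega>\<bar>)"
    by (rule limit_process[of t]) blast
  \<comment> \<open>The null set may depend on \<open>u\<close>, as the notion of a modification
    allows.\<close>
  have "AE \<omega> in M. Y u \<omega> = X u t \<omega>" if u: "u \<in> {0..1}" for u
    using Y(3) by (intro forward_limit_unique[OF u assms(5)[OF u] _ Y(1)[OF u]])
      (auto elim: eventually_mono intro: u)
  then show "\<exists>Xhat :: real \<Rightarrow> 'a \<Rightarrow> real.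
           (\<forall>u\<in>{0..1}. Xhat u \<in> borel_measurable M) \<and>
           (\<forall>\<omega>\<in>space M. continuous_on {0..1} (\<lambda>u. Xhat u \<omega>)) \<and>
           (\<forall>u\<in>{0..1}. AE \<omega> in M. Xhat u \<omega> = X u t \<omega>) \<and>
           in_Lq M q (\<lambda>\<omega>. SUP u\<in>{0..1}. ennreal \<bar>Xhat u \<omega>\<bar>)"
    using Y by blast
qed

end
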